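(* Let $X$ be a Banach space, let $\delta\in(0,1]$, and let $\mathcal S_\delta=\{\mathcal S_\delta(t)\}_{t\ge 0}\subset\mathcal L(X)$ be a $C_0$--$\delta$--semigroup on $X$. Let $\Psi(t)=t^\delta/\delta$ for $t\ge 0$, so that $\Psi^{-1}(s)=(\delta s)^{1/\delta}$ for $s\ge 0$, and define $$\mathcal T(s):=\mathcal S_\delta\bigl(\Psi^{-1}(s)\bigr)=\mathcal S_\delta\bigl((\delta s)^{1/\delta}\bigr),\qquad s\ge 0.$$ Then the family $\{\mathcal T(s)\}_{s\ge 0}$ is a (classical) $C_0$-semigroup on $X$.
   Context: $\mathcal L(X)$ denotes the bounded linear operators on $X$. A family $\{\mathcal S_\delta(t)\}_{t\ge0}\subset\mathcal L(X)$ is a conformable $\delta$--semigroup if $\mathcal S_\delta(0)=\mathrm{Id}$ and $\mathcal S_\delta((r+q)^{1/\delta})=\mathcal S_\delta(r^{1/\delta})\,\mathcal S_\delta(q^{1/\delta})$ for all $r,q\ge 0$. It is a $C_0$--$\delta$--semigroup if in addition $\lim_{t\to0^+}\mathcal S_\delta(t)x=x$ for all $x\in X$. *)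

theory Defs
  imports "HOL-Analysis.Analysis"
begin

(* Families indexed by t >= 0 are functions on the reals; only their values at
   nonnegative arguments are constrained or used. *)

definition delta_semigroup ::
    "real \<Rightarrow> (real \<Rightarrow> 'a::real_normed_vector \<Rightarrow>\<^sub>L 'a) \<Rightarrow> bool" where
  "delta_semigroup \<delta> S \<longleftrightarrow>
     S 0 = id_blinfun \<and>
     (\<forall>r\<ge>0. \<forall>q\<ge>0.
        S ((r + q) powr (1 / \<delta>)) = S (r powr (1 / \<delta>)) o\<^sub>L S (q powr (1 / \<delta>)))"

definition C0_delta_semigroup ::
    "real \<Rightarrow> (real \<Rightarrow> 'a::real_normed_vector \<Rightarrow>\<^sub>L 'a) \<Rightarrow> bool" where
  "C0_delta_semigroup \<delta> S \<longleftrightarrow>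
     delta_semigroup \<delta> S \<and>
     (\<forall>x. ((\<lambda>t. blinfun_apply (S t) x) \<longlongrightarrow> x) (at_right 0))"

definition C0_semigroup :: "(real \<Rightarrow> 'a::real_normed_vector \<Rightarrow>\<^sub>L 'a) \<Rightarrow> bool" where
  "C0_semigroup T \<longleftrightarrow>
     T 0 = id_blinfun \<and>
     (\<forall>r\<ge>0. \<forall>q\<ge>0. T (r + q) = T r o\<^sub>L T q) \<and>
     (\<forall>x. ((\<lambda>t. blinfun_apply (T t) x) \<longlongrightarrow> x) (at_right 0))"

definition Psi :: "real \<Rightarrow> real \<Rightarrow> real" where
  "Psi \<delta> t = t powr \<delta> / \<delta>"

definition Psi_inv :: "real \<Rightarrow> real \<Rightarrow> real" where
  "Psi_inv \<delta> = inv_into {0..} (Psi \<delta>)"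

end

theory Submission
  imports Defs
begin

text \<open>The \<delta>-semigroup law is additivity in the variable t^\<delta>, and
  \<open>Psi\<close> is that variable up to the factor 1/\<delta>. Reparametrizing by
  \<open>Psi_inv\<close> therefore turns the law into the classical one. Strong continuity at 0
  carries over because \<open>Psi_inv\<close> maps small positive times to small positive times
  (\<open>filterlim_Psi_inv_at_right_0\<close>). All of this rests on the closed form
  \<open>Psi_inv_eq\<close>.\<close>

lemma Psi_powr_inverse:
  assumes "0 < \<delta>" "0 \<le> s"
  shows "Psi \<delta> ((\<delta> * s) powr (1 / \<delta>)) = s"
  using assms by (simp add: Psi_def powr_powr)

lemma powr_inverse_Psi:
  assumes "0 < \<delta>" "0 \<le> t"
  shows "(\<delta> * Psi \<delta> t) powr (1 / \<delta>) = t"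
  using assms by (simp add: Psi_def powr_powr)

lemma bij_betw_Psi:
  assumes "0 < \<delta>"
  shows "bij_betw (Psi \<delta>) {0..} {0..}"
proof (rule bij_betw_byWitness[where f' = "\<lambda>s. (\<delta> * s) powr (1 / \<delta>)"])
  show "Psi \<delta> ` {0..} \<subseteq> {0..}"
    using assms by (auto simp: Psi_def)
qed (use assms in \<open>auto simp: Psi_powr_inverse powr_inverse_Psi\<close>)

text \<open>Injectivity of \<open>Psi\<close> on the half-line determines the choice made by
  \<open>inv_into\<close>, so exhibiting one nonnegative preimage of s suffices.\<close>

lemma Psi_inv_eq:
  assumes "0 < \<delta>" "0 \<le> s"
  shows "Psi_inv \<delta> s = (\<delta> * s) powr (1 / \<delta>)"
  unfolding Psi_inv_def
  using bij_betw_Psi[OF assms(1)] assms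
  by (intro inv_into_f_eq) (auto simp: bij_betw_def Psi_powr_inverse)

text \<open>Continuity of \<open>S\<close> is given only along positive times, so the target filter
  is \<open>at_right 0\<close>: beyond convergence to 0, the values must be eventually
  positive.\<close>

lemma filterlim_Psi_inv_at_right_0:
  assumes "0 < \<delta>"
  shows "filterlim (Psi_inv \<delta>) (at_right 0) (at_right 0)"
proof -
  \<comment> \<open>The base tends to 0, where \<open>tendsto_powr'\<close> asks for a positive
    limit exponent and an eventually nonnegative base.\<close>
  have "((\<lambda>s. (\<delta> * s) powr (1 / \<delta>)) \<longlongrightarrow> (\<delta> * 0) powr (1 / \<delta>)) (at_right 0)"
    using assms
    by (intro tendsto_powr' tendsto_intros)
       (auto intro: eventually_mono[OF eventually_at_right_less[of 0]])
  moreover have "\<forall>\<^sub>F s in at_right 0. (\<delta> * s) powr (1 / \<delta>) > 0"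
    using eventually_at_right_less[of "0::real"] by eventually_elim (use assms in simp)
  ultimately have "filterlim (\<lambda>s. (\<delta> * s) powr (1 / \<delta>)) (at_right 0) (at_right 0)"
    by (intro tendsto_imp_filterlim_at_right) simp_all
  moreover have "\<forall>\<^sub>F s in at_right 0. Psi_inv \<delta> s = (\<delta> * s) powr (1 / \<delta>)"
    using eventually_at_right_less[of "0::real"]
    by eventually_elim (use assms in \<open>simp add: Psi_inv_eq\<close>)
  ultimately show ?thesis
    by (simp cong: filterlim_cong)
qed

theorem lemma1:
  fixes S :: "real \<Rightarrow> 'a::banach \<Rightarrow>\<^sub>L 'a" and \<delta> :: real
  assumes "\<delta> \<in> {0<..1}"
    and "C0_delta_semigroup \<delta> S"
  shows "bij_betw (Psi \<delta>) {0..} {0..} \<and>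
         (\<forall>s\<ge>0. Psi_inv \<delta> s = (\<delta> * s) powr (1 / \<delta>)) \<and>
         C0_semigroup (\<lambda>s. S (Psi_inv \<delta> s))"
proof (intro conjI)
  have \<delta>: "0 < \<delta>"
    using assms(1) by simp
  show "bij_betw (Psi \<delta>) {0..} {0..}"
    by (rule bij_betw_Psi[OF \<delta>])
  show "\<forall>s\<ge>0. Psi_inv \<delta> s = (\<delta> * s) powr (1 / \<delta>)"
    using Psi_inv_eq[OF \<delta>] by blast
  have S: "delta_semigroup \<delta> S"
    and lim: "((\<lambda>t. S t x) \<longlongrightarrow> x) (at_right 0)" for x
    using assms(2) by (auto simp: C0_delta_semigroup_def)
  show "C0_semigroup (\<lambda>s. S (Psi_inv \<delta> s))"
    unfolding C0_semigroup_def
  proof (intro conjI allI impI)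
    \<comment> \<open>Here \<open>0 powr (1 / \<delta>)\<close> is 0.\<close>
    show "S (Psi_inv \<delta> 0) = id_blinfun"
      using S \<delta> by (simp add: Psi_inv_eq delta_semigroup_def)
    \<comment> \<open>This is the \<delta>-law at \<delta> r and \<delta> q, since \<delta> (r + q)
      = \<delta> r + \<delta> q.\<close>
    show "S (Psi_inv \<delta> (r + q)) = S (Psi_inv \<delta> r) o\<^sub>L S (Psi_inv \<delta> q)"
      if "0 \<le> r" "0 \<le> q" for r q
      using S \<delta> that by (simp add: Psi_inv_eq delta_semigroup_def distrib_left)
    show "((\<lambda>s. S (Psi_inv \<delta> s) x) \<longlongrightarrow> x) (at_right 0)" for x
      using lim filterlim_Psi_inv_at_right_0[OF \<delta>] by (rule filterlim_compose)
  qed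
qed

end
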